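(* Let $n \geq 2$ be an integer and let $\alpha \in (0,n)$. There exist a metric space $(X,d)$ and a quasisymmetric homeomorphism $f\colon [0,1]^n \rightarrow X$ (with $[0,1]^n$ carrying the Euclidean metric) with the property that $f$ maps some Borel set $E \subset [0,1]^n$ of full Lebesgue measure (that is, $|[0,1]^n\setminus E| = 0$) onto a subset $f(E)$ of $X$ with Hausdorff dimension at most $\alpha$.
   Context: A homeomorphism $f\colon (X,d_X) \rightarrow (Y,d_Y)$ between metric spaces is quasisymmetric if there exists a homeomorphism $\eta\colon [0, \infty) \rightarrow [0, \infty)$ such that $$\frac{d_Y(f(x),f(y))}{d_Y(f(x),f(z))} \leq \eta\left( \frac{d_X(x,y)}{d_X(x,z)} \right)$$ for all triples of distinct points $x,y,z \in X$. $|E|$ denotes the Lebesgue $n$-measure of $E$. Hausdorff dimension in $X$ is taken with respect to the metric $d$. *)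

theory Defs
  imports "HOL-Analysis.Analysis"
begin

definition unit_cube :: "(real ^ 'n) set"
  where "unit_cube = {x. \<forall>i. 0 \<le> x $ i \<and> x $ i \<le> 1}"

text \<open>The unit cube as a metric space; \<open>dist\<close> on \<open>real ^ 'n\<close> is the Euclidean metric.\<close>

definition cube_metric :: "(real ^ 'n) metric"
  where "cube_metric = submetric euclidean_metric unit_cube"

definition quasisymmetric_map :: "'a metric \<Rightarrow> 'b metric \<Rightarrow> ('a \<Rightarrow> 'b) \<Rightarrow> bool"
  where "quasisymmetric_map X Y f \<longleftrightarrow>
    homeomorphic_map (mtopology_of X) (mtopology_of Y) f \<and>
    (\<exists>\<eta> :: real \<Rightarrow> real.
       homeomorphic_map (top_of_set {0..}) (top_of_set {0..}) \<eta> \<and>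
       (\<forall>x \<in> mspace X. \<forall>y \<in> mspace X. \<forall>z \<in> mspace X.
          x \<noteq> y \<longrightarrow> y \<noteq> z \<longrightarrow> x \<noteq> z \<longrightarrow>
          mdist Y (f x) (f y) / mdist Y (f x) (f z) \<le> \<eta> (mdist X x y / mdist X x z)))"

text \<open>The diameter takes values in \<open>[0, \<infinity>]\<close>; it is \<open>0\<close> for the empty set and \<open>\<infinity>\<close> for
  unbounded sets.\<close>

definition mdiameter :: "'a metric \<Rightarrow> 'a set \<Rightarrow> ennreal"
  where "mdiameter X U = (SUP x\<in>U. SUP y\<in>U. ennreal (mdist X x y))"

text \<open>The term \<open>diam(U)^s\<close> in the definition of Hausdorff measure. It is only applied to sets of
  finite diameter. As usual, for \<open>s = 0\<close> it is \<open>1\<close> on nonempty sets and \<open>0\<close> on the empty set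
  (note that \<open>0 powr 0 = 0\<close> in HOL).\<close>

definition diam_pow :: "'a metric \<Rightarrow> real \<Rightarrow> 'a set \<Rightarrow> ennreal"
  where "diam_pow X s U =
    (if U = {} then 0 else if s = 0 then 1 else ennreal (enn2real (mdiameter X U) powr s))"

definition hausdorff_premeasure :: "'a metric \<Rightarrow> real \<Rightarrow> real \<Rightarrow> 'a set \<Rightarrow> ennreal"
  where "hausdorff_premeasure X s \<delta> A =
    (INF U \<in> {U :: nat \<Rightarrow> 'a set.
                (\<forall>i. U i \<subseteq> mspace X \<and> mdiameter X (U i) \<le> ennreal \<delta>) \<and> A \<subseteq> (\<Union>i. U i)}.
       \<Sum>i. diam_pow X s (U i))"

definition hausdorff_measure :: "'a metric \<Rightarrow> real \<Rightarrow> 'a set \<Rightarrow> ennreal"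
  where "hausdorff_measure X s A = (SUP \<delta> \<in> {0<..}. hausdorff_premeasure X s \<delta> A)"

definition hausdorff_dim :: "'a metric \<Rightarrow> 'a set \<Rightarrow> ennreal"
  where "hausdorff_dim X A = Inf {ennreal s | s. 0 \<le> s \<and> hausdorff_measure X s A = 0}"

end

theory Submission
  imports Defs
begin

text \<open>The map is the identity; only the metric on the cube changes. Give every triadic cell a weight:
  passing to a child halves it, except that passing to the central child multiplies it by a tiny
  number \<open>e\<close>. Let \<open>d(x, y)\<close> be the supremum of \<open>|F x - F y|\<close> over all functions \<open>F\<close> that oscillate on
  each cell by at most its weight. Adjacent cells of the same level have comparable weights, because
  central children do not touch the boundary of their parents. So \<open>d(x, y)\<close> is at most a constant times
  the weight of the cell of \<open>x\<close> of side about \<open>|x - y|\<close>. The matching lower bound comes from test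
  functions built from the Cantor function of each coordinate. Hence the identity is quasisymmetric,
  with gauge a multiple of \<open>max (sqrt t) (t ^ b)\<close> where \<open>e = 3\<^sup>-\<^sup>b\<close>.

  Lebesgue-almost every point lies in a central child for a positive proportion of the levels. If \<open>e\<close>
  is small enough, the weight to the power \<open>\<alpha>\<close> of a typical cell of level \<open>k\<close> is therefore much smaller
  than its Lebesgue measure, and the points that lie in infinitely many such cells form the set \<open>E\<close>.\<close>

section \<open>The Cantor function\<close>

text \<open>Mass of the interval from \<open>p / 3 ^ j\<close> to \<open>(p + 1) / 3 ^ j\<close>
  when every unit interval of the half-line carries a copy of the Cantor measure. Leaving
  \<open>p\<close> unrestricted allows arguments of the form \<open>3 ^ k * x\<close>.\<close>

primrec cantor_mass :: "nat \<Rightarrow> nat \<Rightarrow> real" where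
  "cantor_mass 0 p = 1"
| "cantor_mass (Suc j) p = cantor_mass j (p div 3) * (if p mod 3 = 1 then 0 else 1 / 2)"

definition cantor_cum :: "nat \<Rightarrow> nat \<Rightarrow> real"
  where "cantor_cum j p = (\<Sum>q<p. cantor_mass j q)"

text \<open>Distribution function of that measure. For nonnegative \<open>x\<close> the terms
  increase with \<open>j\<close>, so the supremum is their limit.\<close>

definition cantor :: "real \<Rightarrow> real"
  where "cantor x = (SUP j. cantor_cum j (nat \<lfloor>3 ^ j * x\<rfloor>))"

lemma cantor_mass_nonneg: "0 \<le> cantor_mass j p"
  by (induction j arbitrary: p) auto

lemma cantor_cum_mono: "p \<le> q \<Longrightarrow> cantor_cum j p \<le> cantor_cum j q"
  unfolding cantor_cum_def by (intro sum_mono2) (auto simp: cantor_mass_nonneg)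

lemma cantor_cum_Suc: "cantor_cum j (Suc p) = cantor_cum j p + cantor_mass j p"
  by (simp add: cantor_cum_def)

lemma cantor_cum_0: "cantor_cum 0 p = real p"
  by (simp add: cantor_cum_def)

text \<open>The three thirds of an interval carry 1/2, 0 and 1/2 of its mass, so refining the grid
  preserves cumulative mass.\<close>

lemma cantor_cum_Suc_mult3: "cantor_cum (Suc j) (3 * p) = cantor_cum j p"
proof (induction p)
  case (Suc p)
  have "3 * Suc p = Suc (Suc (Suc (3 * p)))" "Suc (3 * p) div 3 = p" "Suc (Suc (3 * p)) div 3 = p"
    "Suc (3 * p) mod 3 = 1" "Suc (Suc (3 * p)) mod 3 = 2"
    by presburger+
  then show ?case
    using Suc by (simp only: cantor_cum_Suc cantor_mass.simps) simp
qed (simp add: cantor_cum_def)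

lemma cantor_cum_add_mult: "cantor_cum (j + m) (3 ^ m * p) = cantor_cum j p"
proof (induction m)
  case (Suc m)
  have "cantor_cum (j + Suc m) (3 ^ Suc m * p) = cantor_cum (Suc (j + m)) (3 * (3 ^ m * p))"
    by (simp add: mult.assoc)
  then show ?case using Suc by (simp only: cantor_cum_Suc_mult3)
qed simp

text \<open>On the finer of the two grids both sides become cumulative masses that monotonicity
  compares. The bound is uniform in \<open>m\<close>, so the supremum defining \<open>cantor\<close>
  is finite.\<close>

lemma cantor_cum_bound:
  assumes "0 \<le> x" "x \<le> (real p + 1) / 3 ^ j"
  shows "cantor_cum m (nat \<lfloor>3 ^ m * x\<rfloor>) \<le> cantor_cum j (Suc p)"
proof (cases "j \<le> m")
  case True
  then obtain l where m: "m = j + l" using le_Suc_ex by blast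
  have "3 ^ j * x \<le> real p + 1"
    using assms(2) by (simp add: field_simps)
  from mult_left_mono[OF this, of "3 ^ l"] have "3 ^ m * x \<le> real (3 ^ l * Suc p)"
    by (simp add: m power_add algebra_simps)
  then have "\<lfloor>3 ^ m * x\<rfloor> \<le> int (3 ^ l * Suc p)"
    by linarith
  then have "nat \<lfloor>3 ^ m * x\<rfloor> \<le> 3 ^ l * Suc p"
    by linarith
  then have "cantor_cum m (nat \<lfloor>3 ^ m * x\<rfloor>) \<le> cantor_cum m (3 ^ l * Suc p)"
    by (rule cantor_cum_mono)
  then show ?thesis by (simp only: m cantor_cum_add_mult)
next
  case False
  then obtain l where j: "j = m + l" using le_Suc_ex nat_le_linear by metis
  let ?q = "nat \<lfloor>3 ^ m * x\<rfloor>"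
  have "real ?q \<le> 3 ^ m * x" using assms(1) by simp
  then have "3 ^ l * real ?q \<le> 3 ^ l * (3 ^ m * x)"
    by (intro mult_left_mono) auto
  also have "\<dots> \<le> real (Suc p)"
    using assms(2) by (simp add: j power_add field_simps)
  finally have "real (3 ^ l * ?q) \<le> real (Suc p)"
    by simp
  then have "3 ^ l * ?q \<le> Suc p" by linarith
  then have "cantor_cum j (3 ^ l * ?q) \<le> cantor_cum j (Suc p)"
    by (rule cantor_cum_mono)
  then show ?thesis by (simp only: j cantor_cum_add_mult)
qed

lemma cantor_bounds:
  assumes "real p / 3 ^ j \<le> x" "x \<le> (real p + 1) / 3 ^ j"
  shows "cantor_cum j p \<le> cantor x" "cantor x \<le> cantor_cum j (Suc p)"
proof -
  have x0: "0 \<le> x"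
    using assms(1) by (smt (verit) divide_nonneg_nonneg of_nat_0_le_iff zero_le_power)
  show "cantor x \<le> cantor_cum j (Suc p)"
    unfolding cantor_def by (intro cSUP_least cantor_cum_bound x0 assms(2)) auto
  have "real p \<le> 3 ^ j * x"
    using assms(1) by (simp add: field_simps)
  then have "p \<le> nat \<lfloor>3 ^ j * x\<rfloor>"
    by (simp add: le_nat_iff le_floor_iff)
  then have "cantor_cum j p \<le> cantor_cum j (nat \<lfloor>3 ^ j * x\<rfloor>)"
    by (rule cantor_cum_mono)
  also have "\<dots> \<le> cantor x"
    unfolding cantor_def
    by (intro cSUP_upper bdd_aboveI2[where M = "cantor_cum j (Suc p)"] cantor_cum_bound x0 assms(2)) auto
  finally show "cantor_cum j p \<le> cantor x" .
qed

lemma cantor_osc: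
  assumes "real p / 3 ^ j \<le> x" "x \<le> (real p + 1) / 3 ^ j"
    and "real p / 3 ^ j \<le> y" "y \<le> (real p + 1) / 3 ^ j"
  shows "\<bar>cantor x - cantor y\<bar> \<le> cantor_mass j p"
  using cantor_bounds[OF assms(1,2)] cantor_bounds[OF assms(3,4)] cantor_cum_Suc[of j p]
  by linarith

text \<open>The whole unit interval from \<open>p + 1\<close> to \<open>p + 2\<close> lies between
  the two points, and \<open>cantor\<close> rises by 1 across it.\<close>

lemma cantor_separation:
  assumes "0 \<le> x" "x \<le> real p + 1" "real q \<le> y" "p + 2 \<le> q"
  shows "cantor x + 1 \<le> cantor y"
proof -
  have "cantor x \<le> real p + 1"
    unfolding cantor_def
  proof (rule cSUP_least)
    fix m
    show "cantor_cum m (nat \<lfloor>3 ^ m * x\<rfloor>) \<le> real p + 1"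
      using cantor_cum_bound[of x p 0 m] assms(1,2) by (simp add: cantor_cum_0)
  qed simp
  moreover have "real (nat \<lfloor>y\<rfloor>) \<le> cantor y"
    using cantor_bounds(1)[of "nat \<lfloor>y\<rfloor>" 0 y] assms(3) by (simp add: cantor_cum_0)
  moreover have "real q \<le> real (nat \<lfloor>y\<rfloor>)"
    using assms(3) le_nat_floor of_nat_le_iff by blast
  ultimately show ?thesis using assms(4) by linarith
qed

section \<open>Cascade weights\<close>

text \<open>The vectors \<open>v\<close> index the triadic cells of side \<open>3\<^sup>-\<^sup>k\<close> in the nonnegative orthant; a cell is the
  central child of its parent if and only if all entries of its index are 1 modulo 3.\<close>

primrec weight :: "real \<Rightarrow> nat \<Rightarrow> ('n \<Rightarrow> nat) \<Rightarrow> real" where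
  "weight e 0 v = 1"
| "weight e (Suc k) v =
    weight e k (\<lambda>i. v i div 3) * (if \<forall>i. v i mod 3 = 1 then e else 1 / 2)"

section \<open>Arithmetic of floors and ternary digits\<close>

lemma nat_floor_le_Suc: "a \<le> b + 1 \<Longrightarrow> 0 \<le> b \<Longrightarrow> nat \<lfloor>a\<rfloor> \<le> nat \<lfloor>b\<rfloor> + 1"
  for a b :: real
  using floor_mono[of a "b + 1"] by simp

lemma nat_floor_add2_le: "a + 2 \<le> b \<Longrightarrow> 0 \<le> a \<Longrightarrow> nat \<lfloor>a\<rfloor> + 2 \<le> nat \<lfloor>b\<rfloor>"
  for a b :: real
  using floor_mono[of "a + 2" b] by (simp; linarith)

text \<open>The neighbours of a last digit 1 are the digits 0 and 2 under the same parent.\<close>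

lemma div3_eq_if_middle:
  fixes a b :: nat
  assumes "a \<le> b + 1" "b \<le> a + 1" "a mod 3 = 1"
  shows "a div 3 = b div 3"
proof -
  define q where "q = a div 3"
  have "a = 3 * q + 1" using assms(3) by (metis q_def mult_div_mod_eq)
  then have "b = 3 * q \<or> b = 3 * q + 1 \<or> b = 3 * q + 2" using assms(1,2) by linarith
  then show ?thesis unfolding q_def[symmetric] by auto
qed

text \<open>The upper bound on \<open>e\<close> ensures that every child, central or not, weighs at
  most half its parent.\<close>

locale cascade =
  fixes e :: real
  assumes e_pos: "0 < e" and e_le: "e \<le> 1 / 2"
begin

lemma weight_pos: "0 < weight e k v"
  using e_pos by (induction k arbitrary: v) auto

lemma weight_nonneg: "0 \<le> weight e k v"
  using weight_pos by (rule less_imp_le)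

lemma weight_Suc_le: "weight e (Suc k) v \<le> weight e k (\<lambda>i. v i div 3) / 2"
  using weight_pos[of k "\<lambda>i. v i div 3"] e_le mult_left_mono[OF e_le] by fastforce

lemma weight_Suc_ge: "e * weight e k (\<lambda>i. v i div 3) \<le> weight e (Suc k) v"
  using weight_pos[of k "\<lambda>i. v i div 3"] e_le mult_left_mono[OF e_le] by fastforce

lemma weight_le: "weight e k v \<le> (1 / 2) ^ k"
proof (induction k arbitrary: v)
  case (Suc k)
  show ?case using weight_Suc_le[of k v] Suc[of "\<lambda>i. v i div 3"] by (simp del: weight.simps)
qed simp

lemma weight_add_le: "weight e (k + m) v \<le> (1 / 2) ^ m * weight e k (\<lambda>i. v i div 3 ^ m)"
proof (induction m arbitrary: v)
  case (Suc m)
  show ?case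
    using weight_Suc_le[of "k + m" v] Suc[of "\<lambda>i. v i div 3"]
    by (simp del: weight.simps add: div_mult2_eq)
qed simp

lemma weight_add_ge: "e ^ m * weight e k (\<lambda>i. v i div 3 ^ m) \<le> weight e (k + m) v"
proof (induction m arbitrary: v)
  case (Suc m)
  have "e * (e ^ m * weight e k (\<lambda>i. v i div 3 div 3 ^ m)) \<le> e * weight e (k + m) (\<lambda>i. v i div 3)"
    using Suc e_pos by (intro mult_left_mono) auto
  also have "\<dots> \<le> weight e (k + Suc m) v"
    using weight_Suc_ge[of "k + m" v] by simp
  finally show ?case by (simp add: div_mult2_eq mult.assoc del: weight.simps)
qed simp

text \<open>One coordinate suffices: if its last digit is 1, the Cantor mass vanishes; otherwise the
  cell is not a central child, and weight and Cantor mass both halve. So no power of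
  \<open>e\<close> enters the estimate.\<close>

lemma weight_add_ge_cantor:
  "weight e k (\<lambda>i. v i div 3 ^ m) * cantor_mass m (v i) \<le> weight e (k + m) v"
proof (induction m arbitrary: v)
  case (Suc m)
  have *: "weight e k (\<lambda>i. v i div 3 div 3 ^ m) * cantor_mass m (v i div 3) \<le> weight e (k + m) (\<lambda>i. v i div 3)"
    using Suc .
  show ?case
  proof (cases "v i mod 3 = 1")
    case True
    then show ?thesis using less_imp_le[OF weight_pos[of "k + Suc m" v]] by simp
  next
    case False
    then have "(\<forall>i. v i mod 3 = 1) \<longleftrightarrow> False" by blast
    then show ?thesis using * False by (simp only: weight.simps cantor_mass.simps add_Suc_right div_mult2_eq power_Suc) simp
  qed
qed simp

text \<open>If the parents of two adjacent cells differ, then their last digits are 0 and 2 in some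
  coordinate, so neither cell is a middle child.\<close>

lemma weight_adjacent:
  assumes "\<And>i. u i \<le> v i + 1" "\<And>i. v i \<le> u i + 1"
  shows "2 * e * weight e k u \<le> weight e k v"
  using assms
proof (induction k arbitrary: u v)
  case 0
  then show ?case using e_le by simp
next
  case (Suc k)
  let ?u = "\<lambda>i. u i div 3" and ?v = "\<lambda>i. v i div 3"
  show ?case
  proof (cases "?u = ?v")
    case True
    \<comment> \<open>Siblings weigh between \<open>e\<close> and 1/2 times their parent, which
      produces the factor \<open>2 * e\<close>.\<close>
    have "2 * e * weight e (Suc k) u \<le> 2 * e * (weight e k ?u / 2)"
      using weight_Suc_le[of k u] e_pos by (intro mult_left_mono) auto
    also have "\<dots> \<le> weight e (Suc k) v"
      using weight_Suc_ge[of k v] True by simp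
    finally show ?thesis .
  next
    case False
    then obtain i where "u i div 3 \<noteq> v i div 3" by blast
    then have "u i mod 3 \<noteq> 1" "v i mod 3 \<noteq> 1"
      using div3_eq_if_middle[of "u i" "v i"] div3_eq_if_middle[of "v i" "u i"] Suc.prems by metis+
    then have 1: "(\<forall>i. u i mod 3 = 1) \<longleftrightarrow> False" "(\<forall>i. v i mod 3 = 1) \<longleftrightarrow> False" by blast+
    have "2 * e * weight e k ?u \<le> weight e k ?v"
    proof (rule Suc.IH)
      fix i
      show "u i div 3 \<le> v i div 3 + 1" "v i div 3 \<le> u i div 3 + 1"
        using div_le_mono[of "u i" "v i + 3" 3] div_le_mono[of "v i" "u i + 3" 3] Suc.prems[of i]
        by simp_all
    qed
    then show ?thesis using 1 by (simp only: weight.simps) simp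
  qed
qed

end

section \<open>The metric\<close>

definition cell :: "nat \<Rightarrow> ('n \<Rightarrow> nat) \<Rightarrow> (real ^ 'n) set"
  where "cell k v = cbox (\<chi> i. real (v i) / 3 ^ k) (\<chi> i. (real (v i) + 1) / 3 ^ k)"

text \<open>Closed cells overlap; the floor selects one of them. At a coordinate equal to 1 the
  index is \<open>3 ^ k\<close>, a cell outside the cube that still has a weight.\<close>

definition addr :: "nat \<Rightarrow> real ^ 'n \<Rightarrow> 'n \<Rightarrow> nat"
  where "addr k x = (\<lambda>i. nat \<lfloor>3 ^ k * x $ i\<rfloor>)"

definition adjacent :: "('n \<Rightarrow> nat) \<Rightarrow> ('n \<Rightarrow> nat) \<Rightarrow> bool"
  where "adjacent u v \<longleftrightarrow> (\<forall>i. u i \<le> v i + 1 \<and> v i \<le> u i + 1)"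

text \<open>The bound by 1 keeps the supremum in \<open>cdist\<close> finite off the unit cube as well.\<close>

definition controlled :: "real \<Rightarrow> (real ^ 'n \<Rightarrow> real) set"
  where "controlled e = {F. (\<forall>x. 0 \<le> F x \<and> F x \<le> 1) \<and>
    (\<forall>k v. \<forall>x \<in> cell k v. \<forall>y \<in> cell k v. \<bar>F x - F y\<bar> \<le> weight e k v)}"

definition cdist :: "real \<Rightarrow> real ^ 'n \<Rightarrow> real ^ 'n \<Rightarrow> real"
  where "cdist e x y = (SUP F \<in> controlled e. \<bar>F x - F y\<bar>)"

section \<open>Triadic cells and their refinement\<close>

lemma mem_cell:
  "x \<in> cell k v \<longleftrightarrow> (\<forall>i. real (v i) \<le> 3 ^ k * x $ i \<and> 3 ^ k * x $ i \<le> real (v i) + 1)"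
  by (simp add: cell_def mem_box_cart field_simps)

lemma cell_nonneg:
  assumes "x \<in> cell k v"
  shows "0 \<le> x $ i"
proof -
  have "(0::real) * 3 ^ k \<le> x $ i * 3 ^ k"
    using assms unfolding mem_cell by (metis mult.commute mult_zero_left of_nat_0_le_iff order_trans)
  then show ?thesis by (rule mult_right_le_imp_le) simp
qed

lemma addr_in_cell: "(\<And>i. 0 \<le> x $ i) \<Longrightarrow> x \<in> cell k (addr k x)"
  unfolding mem_cell addr_def by (simp add: less_imp_le)

lemma addr_div:
  "addr (k + m) x i div 3 ^ m = addr k x i"
proof -
  have "\<lfloor>3 ^ k * x $ i\<rfloor> = \<lfloor>3 ^ (k + m) * x $ i / real_of_int (3 ^ m)\<rfloor>"
    by (simp add: power_add)
  also have "\<dots> = \<lfloor>3 ^ (k + m) * x $ i\<rfloor> div 3 ^ m"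
    by (rule floor_divide_real_eq_div) simp
  finally show ?thesis
    unfolding addr_def by (simp add: nat_div_distrib' nat_power_eq)
qed

lemma cell_subset: "cell (k + m) v \<subseteq> cell k (\<lambda>i. v i div 3 ^ m)"
proof
  fix x :: "real ^ 'a"
  assume x: "x \<in> cell (k + m) v"
  show "x \<in> cell k (\<lambda>i. v i div 3 ^ m)"
    unfolding mem_cell
  proof (intro allI conjI)
    fix i
    let ?q = "v i div 3 ^ m"
    have b: "real (v i) \<le> 3 ^ m * (3 ^ k * x $ i)" "3 ^ m * (3 ^ k * x $ i) \<le> real (v i) + 1"
      using x by (simp_all add: mem_cell power_add mult_ac)
    have "3 ^ m * ?q \<le> v i" "v i + 1 \<le> 3 ^ m * (?q + 1)"
      using dividend_less_times_div[of "3 ^ m" "v i"] by simp_all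
    then have "real (3 ^ m * ?q) \<le> real (v i)" "real (v i + 1) \<le> real (3 ^ m * (?q + 1))"
      using of_nat_le_iff by blast+
    then have "3 ^ m * real ?q \<le> real (v i)" "real (v i) + 1 \<le> 3 ^ m * (real ?q + 1)"
      by (simp_all add: algebra_simps)
    then have c: "3 ^ m * real ?q \<le> 3 ^ m * (3 ^ k * x $ i)"
      "3 ^ m * (3 ^ k * x $ i) \<le> 3 ^ m * (real ?q + 1)"
      using b by linarith+
    show "real ?q \<le> 3 ^ k * x $ i" "3 ^ k * x $ i \<le> real ?q + 1"
      by (rule mult_left_le_imp_le[OF c(1)], simp) (rule mult_left_le_imp_le[OF c(2)], simp)
  qed
qed

lemma cell_refine:
  assumes "x \<in> cell k v"
  obtains w where "x \<in> cell (k + m) w" "\<And>i. w i div 3 ^ m = v i"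
proof -
  \<comment> \<open>On an upper face of the cell the floor address belongs to a neighbour; the
    minimum pulls it back to the last descendant of \<open>v\<close>.\<close>
  define w where "w = (\<lambda>i. min (addr (k + m) x i) (3 ^ m * v i + (3 ^ m - 1)))"
  have x0: "\<And>i. 0 \<le> x $ i" using assms by (rule cell_nonneg)
  have "x \<in> cell (k + m) w \<and> (\<forall>i. w i div 3 ^ m = v i)"
    unfolding mem_cell all_conj_distrib[symmetric]
  proof
    fix i
    have b: "real (v i) \<le> 3 ^ k * x $ i" "3 ^ k * x $ i \<le> real (v i) + 1"
      using assms by (simp_all add: mem_cell)
    have a: "real (addr (k + m) x i) \<le> 3 ^ (k + m) * x $ i"
      "3 ^ (k + m) * x $ i \<le> real (addr (k + m) x i) + 1"
      using addr_in_cell[OF x0] by (simp_all add: mem_cell)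
    have le: "3 ^ m * v i \<le> addr (k + m) x i"
    proof -
      have "real (3 ^ m * v i) \<le> 3 ^ (k + m) * x $ i"
        using b(1) by (simp add: power_add)
      then show ?thesis
        unfolding addr_def by (rule le_nat_floor)
    qed
    have up: "3 ^ (k + m) * x $ i \<le> real (3 ^ m * v i + (3 ^ m - 1)) + 1"
    proof -
      have "real (3 ^ m * v i + (3 ^ m - 1)) + 1 = real (3 ^ m * v i + (3 ^ m - 1) + 1)"
        by (simp only: of_nat_add of_nat_1)
      also have "3 ^ m * v i + (3 ^ m - 1) + 1 = 3 ^ m * (v i + 1)"
        by simp
      finally show ?thesis
        using mult_left_mono[OF b(2), of "3 ^ m"] by (simp add: power_add algebra_simps)
    qed
    have "w i div 3 ^ m = v i"
    proof (rule div_nat_eqI)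
      show "3 ^ m * v i \<le> w i" unfolding w_def using le by (intro min.boundedI le_add1)
      have "(0::nat) < 3 ^ m" by simp
      then show "w i < 3 ^ m * Suc (v i)" unfolding w_def mult_Suc_right by linarith
    qed
    moreover have "real (w i) \<le> 3 ^ (k + m) * x $ i"
      using a(1) unfolding w_def by linarith
    moreover have "3 ^ (k + m) * x $ i \<le> real (w i) + 1"
      using a(2) up unfolding w_def by linarith
    ultimately show "(real (w i) \<le> 3 ^ (k + m) * x $ i \<and> 3 ^ (k + m) * x $ i \<le> real (w i) + 1) \<and>
        w i div 3 ^ m = v i"
      by simp
  qed
  then show thesis using that by blast
qed

section \<open>Gap functions built from the Cantor function\<close>

lemma infnorm_le_cart:
  fixes x :: "real ^ 'n"
  assumes "\<And>i. \<bar>x $ i\<bar> \<le> c"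
  shows "infnorm x \<le> c"
  unfolding infnorm_cart using assms by (intro cSup_least) auto

text \<open>Pullback of the sup-norm distance under the coordinatewise Cantor function at scale
  \<open>3 ^ k\<close>; the sup norm detects separation in any single coordinate.\<close>

definition cantor_gap :: "nat \<Rightarrow> real ^ 'n \<Rightarrow> real ^ 'n \<Rightarrow> real"
  where "cantor_gap k x y = infnorm (\<chi> i. cantor (3 ^ k * x $ i) - cantor (3 ^ k * y $ i))"

lemma cantor_gap_nonneg: "0 \<le> cantor_gap k x y"
  by (simp add: cantor_gap_def infnorm_pos_le)

lemma cantor_gap_self: "cantor_gap k x x = 0"
  by (simp add: cantor_gap_def infnorm_eq_0 vec_eq_iff)

lemma cantor_gap_diff: "\<bar>cantor_gap k x z - cantor_gap k y z\<bar> \<le> cantor_gap k x y"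
proof -
  let ?c = "\<lambda>x y. \<chi> i. cantor (3 ^ k * x $ i) - cantor (3 ^ k * y $ i)"
  have "?c x z - ?c y z = ?c x y"
    by (simp add: vec_eq_iff)
  then show ?thesis
    unfolding cantor_gap_def using absdiff_infnorm[of "?c x z" "?c y z"] by (simp only:)
qed

lemma cantor_gap_far:
  assumes "x \<in> cell k u" "y \<in> cell k v" "\<not> adjacent u v"
  shows "1 \<le> cantor_gap k x y"
proof -
  obtain i where i: "u i + 2 \<le> v i \<or> v i + 2 \<le> u i"
  proof -
    obtain i where "\<not> (u i \<le> v i + 1 \<and> v i \<le> u i + 1)"
      using assms(3) unfolding adjacent_def by blast
    then have "u i + 2 \<le> v i \<or> v i + 2 \<le> u i" by linarith
    then show thesis by (rule that)
  qed
  have x: "0 \<le> 3 ^ k * x $ i" "real (u i) \<le> 3 ^ k * x $ i" "3 ^ k * x $ i \<le> real (u i) + 1"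
    using assms(1) cell_nonneg[OF assms(1)] by (auto simp: mem_cell)
  have y: "0 \<le> 3 ^ k * y $ i" "real (v i) \<le> 3 ^ k * y $ i" "3 ^ k * y $ i \<le> real (v i) + 1"
    using assms(2) cell_nonneg[OF assms(2)] by (auto simp: mem_cell)
  have "1 \<le> \<bar>cantor (3 ^ k * x $ i) - cantor (3 ^ k * y $ i)\<bar>"
    using i cantor_separation[OF x(1,3) y(2)] cantor_separation[OF y(1,3) x(2)] by linarith
  also have "\<dots> \<le> cantor_gap k x y"
    unfolding cantor_gap_def
    using component_le_infnorm_cart[of "\<chi> i. cantor (3 ^ k * x $ i) - cantor (3 ^ k * y $ i)" i]
    by simp
  finally show ?thesis .
qed

lemma cantor_gap_cell:
  assumes "x \<in> cell (k + m) v" "y \<in> cell (k + m) v" "\<And>i. cantor_mass m (v i) \<le> c"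
  shows "cantor_gap k x y \<le> c"
  unfolding cantor_gap_def
proof (rule infnorm_le_cart)
  fix i
  have "\<bar>cantor (3 ^ k * x $ i) - cantor (3 ^ k * y $ i)\<bar> \<le> cantor_mass m (v i)"
    using assms(1,2) unfolding mem_cell
    by (intro cantor_osc) (simp_all add: power_add field_simps)
  then show "\<bar>(\<chi> i. cantor (3 ^ k * x $ i) - cantor (3 ^ k * y $ i)) $ i\<bar> \<le> c"
    using assms(3)[of i] by simp
qed

section \<open>The distance and its comparison with cell weights\<close>

context cascade
begin

lemma const_controlled: "(\<lambda>_. 0) \<in> controlled e"
  by (simp add: controlled_def less_imp_le[OF weight_pos])

lemma cdist_upper:
  assumes "F \<in> controlled e"
  shows "\<bar>F x - F y\<bar> \<le> cdist e x y"
  unfolding cdist_def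
proof (intro cSUP_upper[OF assms] bdd_aboveI2)
  fix G :: "real ^ 'a \<Rightarrow> real"
  assume "G \<in> controlled e"
  then have "0 \<le> G x" "G x \<le> 1" "0 \<le> G y" "G y \<le> 1" by (auto simp: controlled_def)
  then show "\<bar>G x - G y\<bar> \<le> 1" by linarith
qed

lemma cdist_least: "(\<And>F. F \<in> controlled e \<Longrightarrow> \<bar>F x - F y\<bar> \<le> c) \<Longrightarrow> cdist e x y \<le> c"
  unfolding cdist_def using const_controlled by (intro cSUP_least) auto

lemma cdist_nonneg: "0 \<le> cdist e x y"
  using cdist_upper[OF const_controlled, of x y] by simp

lemma cdist_commute: "cdist e x y = cdist e y x"
  by (simp add: cdist_def abs_minus_commute)

lemma cdist_self: "cdist e x x = 0"
  using cdist_least[of x x 0] cdist_nonneg[of x x] by simp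

lemma cdist_triangle: "cdist e x z \<le> cdist e x y + cdist e y z"
proof (rule cdist_least)
  fix F :: "real ^ 'a \<Rightarrow> real"
  assume "F \<in> controlled e"
  from cdist_upper[OF this, of x y] cdist_upper[OF this, of y z]
  show "\<bar>F x - F z\<bar> \<le> cdist e x y + cdist e y z" by linarith
qed

lemma cdist_cell: "x \<in> cell k v \<Longrightarrow> y \<in> cell k v \<Longrightarrow> cdist e x y \<le> weight e k v"
  by (rule cdist_least) (auto simp: controlled_def)

text \<open>The addresses are adjacent, so the closed cells share a point, and passing through it
  costs the sum of their weights. After multiplication by \<open>e\<close> each summand is at most
  half the weight at \<open>x\<close>.\<close>

lemma cdist_le:
  fixes x y :: "real ^ 'n"
  assumes x0: "\<And>i. 0 \<le> x $ i" and y0: "\<And>i. 0 \<le> y $ i"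
    and near: "\<And>i. \<bar>x $ i - y $ i\<bar> \<le> 1 / 3 ^ k"
  shows "e * cdist e x y \<le> weight e k (addr k x)"
proof -
  let ?u = "addr k x" and ?v = "addr k y"
  \<comment> \<open>A common point of both cells: in each coordinate, the larger of the two lower
    ends.\<close>
  define z :: "real ^ 'n" where "z = (\<chi> i. real (max (?u i) (?v i)) / 3 ^ k)"
  have ad: "?u i \<le> ?v i + 1" "?v i \<le> ?u i + 1" for i
  proof -
    have "\<bar>3 ^ k * x $ i - 3 ^ k * y $ i\<bar> \<le> 1"
      using near[of i] by (simp add: field_simps abs_le_iff)
    moreover have "0 \<le> 3 ^ k * x $ i" "0 \<le> 3 ^ k * y $ i" using x0 y0 by auto
    ultimately show "?u i \<le> ?v i + 1" "?v i \<le> ?u i + 1"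
      unfolding addr_def by (intro nat_floor_le_Suc; linarith)+
  qed
  have "z \<in> cell k ?u" "z \<in> cell k ?v"
  proof -
    have "real (?u i) \<le> real (?v i) + 1" "real (?v i) \<le> real (?u i) + 1" for i
      using ad[of i] by linarith+
    then show "z \<in> cell k ?u" "z \<in> cell k ?v"
      by (simp_all add: mem_cell z_def max_def)
  qed
  then have "cdist e x y \<le> weight e k ?u + weight e k ?v"
    using cdist_triangle[of x y z] cdist_cell[of x k ?u z, OF addr_in_cell[OF x0]]
      cdist_cell[of z k ?v y, OF _ addr_in_cell[OF y0]]
    by linarith
  then have "e * cdist e x y \<le> e * weight e k ?u + e * weight e k ?v"
    using e_pos by (simp add: distrib_left[symmetric])
  moreover have "e * weight e k ?u \<le> 1 / 2 * weight e k ?u"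
    by (intro mult_right_mono e_le weight_nonneg)
  moreover have "2 * e * weight e k ?v \<le> weight e k ?u"
    by (rule weight_adjacent[OF ad(2,1)])
  ultimately show ?thesis by linarith
qed

text \<open>Since \<open>cantor\<close> is constant on middle thirds, the gap function does not vary on a cell that has a
  central cell among its ancestors below level \<open>k\<close>. On every other cell the weight loses exactly a
  factor 2 per level, as does the oscillation of \<open>cantor\<close>.\<close>

lemma truncated_gap_controlled:
  assumes u: "x \<in> cell k u"
  shows "(\<lambda>z. e * weight e k u * min 1 (cantor_gap k z x)) \<in> controlled e"
proof -
  define F where "F = (\<lambda>z. e * weight e k u * min 1 (cantor_gap k z x))"
  let ?W = "e * weight e k u"
  have W0: "0 < ?W" using e_pos weight_pos[of k u] by simp
  have "?W \<le> 1 / 2 * (1 / 2) ^ k"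
    by (intro mult_mono e_le weight_le weight_nonneg) auto
  also have "\<dots> \<le> 1 / 2 * 1"
    by (intro mult_left_mono power_le_one) auto
  finally have W1: "?W \<le> 1" by simp
  have F: "0 \<le> F z" "F z \<le> ?W" for z
    using mult_left_mono[of "min 1 (cantor_gap k z x)" 1 ?W] W0 cantor_gap_nonneg[of k z x]
    by (auto simp: F_def)
  have Fdiff: "\<bar>F y - F z\<bar> \<le> ?W" for y z
    using F[of y] F[of z] by linarith
  \<comment> \<open>Truncation at 1 makes \<open>F\<close> constant away from the neighbours of
    \<open>u\<close>.\<close>
  have Ffar: "F z = ?W" if "z \<in> cell k w" "\<not> adjacent w u" for z w
    using cantor_gap_far[OF that(1) u that(2)] by (simp add: F_def min_def)
  \<comment> \<open>The factor \<open>e\<close> keeps the height of \<open>F\<close> below the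
    weight of every neighbour.\<close>
  have Wadj: "?W \<le> weight e k w" if "adjacent w u" for w
  proof -
    have "2 * e * weight e k u \<le> weight e k w"
      using that unfolding adjacent_def by (intro weight_adjacent) auto
    then show ?thesis using W0 by linarith
  qed
  have "\<bar>F y - F z\<bar> \<le> weight e j v" if yz: "y \<in> cell j v" "z \<in> cell j v" for j v y z
  proof (cases "k \<le> j")
    case True
    then obtain m where j: "j = k + m" using le_Suc_ex by blast
    let ?P = "\<lambda>i. v i div 3 ^ m"
    have P: "y \<in> cell k ?P" "z \<in> cell k ?P"
      using yz cell_subset[of k m v] unfolding j by auto
    show ?thesis
    proof (cases "adjacent ?P u")
      case True
      let ?c = "weight e j v / weight e k ?P"
      have P0: "0 < weight e k ?P" by (rule weight_pos)
      \<comment> \<open>The weight of the cell relative to its ancestor of level \<open>k\<close>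
        dominates the Cantor mass in every coordinate.\<close>
      have "cantor_gap k y z \<le> ?c"
        using yz weight_add_ge_cantor[ of k v m] P0 unfolding j
        by (intro cantor_gap_cell) (auto simp: field_simps)
      then have "\<bar>min 1 (cantor_gap k y x) - min 1 (cantor_gap k z x)\<bar> \<le> ?c"
        using cantor_gap_diff[of k y x z] by linarith
      then have "?W * \<bar>min 1 (cantor_gap k y x) - min 1 (cantor_gap k z x)\<bar> \<le> weight e k ?P * ?c"
        using Wadj[OF True] W0 P0 by (intro mult_mono) auto
      then show ?thesis
        using P0 W0 by (simp add: F_def right_diff_distrib[symmetric] abs_mult[of ?W] del: abs_mult)
    next
      case False
      then show ?thesis
        using Ffar[OF P(1)] Ffar[OF P(2)] weight_pos[ of j v] by simp
    qed
  next
    case False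
    then obtain m where k: "k = j + m" using le_Suc_ex nat_le_linear by metis
    \<comment> \<open>A coarse cell with a descendant next to \<open>u\<close> outweighs that
      descendant, hence the full height of \<open>F\<close>.\<close>
    have near: "?W \<le> weight e j v" if "adjacent w u" "\<And>i. w i div 3 ^ m = v i" for w
    proof -
      have "weight e k w \<le> (1 / 2) ^ m * weight e j v"
        using weight_add_le[ of j m w] that(2) unfolding k by simp
      also have "\<dots> \<le> 1 * weight e j v"
        by (intro mult_right_mono power_le_one weight_nonneg) auto
      finally show ?thesis using Wadj[OF that(1)] by linarith
    qed
    obtain w where w: "y \<in> cell k w" "\<And>i. w i div 3 ^ m = v i"
      using cell_refine[OF yz(1), of m] unfolding k by blast
    obtain w' where w': "z \<in> cell k w'" "\<And>i. w' i div 3 ^ m = v i"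
      using cell_refine[OF yz(2), of m] unfolding k by blast
    show ?thesis
    proof (cases "adjacent w u \<or> adjacent w' u")
      case True
      then have "?W \<le> weight e j v" using near[OF _ w(2)] near[OF _ w'(2)] by blast
      then show ?thesis using Fdiff[of y z] by linarith
    next
      case False
      then show ?thesis
        using Ffar[OF w(1)] Ffar[OF w'(1)] weight_pos[ of j v] by simp
    qed
  qed
  moreover have "0 \<le> F z \<and> F z \<le> 1" for z
    using F[of z] W1 by linarith
  ultimately have "F \<in> controlled e"
    by (simp add: controlled_def)
  then show ?thesis by (simp only: F_def)
qed

text \<open>A separation of two cell sides forces non-adjacent addresses. The truncated gap centred
  at \<open>x\<close> is then 0 at \<open>x\<close> and has its full height at
  \<open>y\<close>.\<close>

lemma cdist_ge:
  fixes x y :: "real ^ 'n"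
  assumes x0: "\<And>i. 0 \<le> x $ i" and y0: "\<And>i. 0 \<le> y $ i"
    and far: "2 / 3 ^ k \<le> \<bar>x $ i - y $ i\<bar>"
  shows "e * weight e k (addr k x) \<le> cdist e x y"
proof -
  have "2 \<le> \<bar>3 ^ k * x $ i - 3 ^ k * y $ i\<bar>"
    using far unfolding right_diff_distrib[symmetric] abs_mult by (simp add: field_simps)
  then have "3 ^ k * x $ i + 2 \<le> 3 ^ k * y $ i \<or> 3 ^ k * y $ i + 2 \<le> 3 ^ k * x $ i"
    by linarith
  moreover have "0 \<le> 3 ^ k * x $ i" "0 \<le> 3 ^ k * y $ i" using x0 y0 by auto
  ultimately have "addr k x i + 2 \<le> addr k y i \<or> addr k y i + 2 \<le> addr k x i"
    unfolding addr_def using nat_floor_add2_le by blast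
  then have "\<not> adjacent (addr k y) (addr k x)"
    unfolding adjacent_def by (intro notI) (drule spec[of _ i], linarith)
  then have "1 \<le> cantor_gap k y x"
    by (intro cantor_gap_far[OF addr_in_cell addr_in_cell] x0 y0)
  then show ?thesis
    using cdist_upper[OF truncated_gap_controlled[OF addr_in_cell[OF x0]], of k y x]
      e_pos weight_pos[ of k "addr k x"]
    by (simp add: cantor_gap_self cdist_commute min_def)
qed

end

section \<open>Quasisymmetry\<close>

text \<open>The inverse of a maximum of two increasing bijections is the minimum of their inverses;
  \<open>c\<close> and \<open>C\<close> only rescale.\<close>

lemma homeomorphic_map_power_gauge:
  fixes c C :: real
  assumes c: "0 < c" and C: "0 < C" and b: "0 < b"
  shows "homeomorphic_map (top_of_set {0..}) (top_of_set {0..})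
    (\<lambda>t. C * max (sqrt (c * t)) ((c * t) ^ b))" (is "homeomorphic_map _ _ ?f")
proof -
  let ?g = "\<lambda>s. min ((s / C)\<^sup>2) (root b (s / C)) / c"
  have gf: "?g (?f t) = t" if "0 \<le> t" for t
  proof -
    define u where "u = c * t"
    have u: "0 \<le> u" "u / c = t" using c that by (simp_all add: u_def)
    have "min ((max (sqrt u) (u ^ b))\<^sup>2) (root b (max (sqrt u) (u ^ b))) = u"
    proof (cases "u ^ b \<le> sqrt u")
      case True
      then have "root b (u ^ b) \<le> root b (sqrt u)" using b by (simp only: real_root_le_iff)
      then show ?thesis using True u b by (simp add: max_def real_root_power_cancel)
    next
      case False
      then have "(sqrt u)\<^sup>2 \<le> (u ^ b)\<^sup>2" using u by (intro power_mono) auto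
      then show ?thesis using False u b by (simp add: max_def real_root_power_cancel)
    qed
    then show ?thesis using C u by (simp add: u_def[symmetric])
  qed
  have fg: "?f (?g s) = s" if "0 \<le> s" for s
  proof -
    define v where "v = s / C"
    have v: "0 \<le> v" "C * v = s" using C that by (simp_all add: v_def)
    let ?m = "min (v\<^sup>2) (root b v)"
    have "max (sqrt ?m) (?m ^ b) = v"
    proof (cases "v\<^sup>2 \<le> root b v")
      case True
      then have "(v\<^sup>2) ^ b \<le> root b v ^ b" by (intro power_mono) auto
      then show ?thesis using True v b by (simp add: real_root_pow_pos2)
    next
      case False
      then have "sqrt (root b v) \<le> sqrt (v\<^sup>2)" by (intro real_sqrt_le_mono) auto
      then show ?thesis using False v b by (simp add: real_root_pow_pos2)
    qed
    then show ?thesis using c v by (simp add: v_def[symmetric])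
  qed
  have "continuous_on {0..} ?f" "continuous_on {0..} ?g"
    using C c by (auto intro!: continuous_intros)
  moreover have "?f \<in> {0..} \<rightarrow> {0..}"
    using C c by (auto simp: le_max_iff_disj)
  moreover have "?g \<in> {0..} \<rightarrow> {0..}"
    using C c b by (auto simp: real_root_ge_zero)
  ultimately have "homeomorphic_maps (top_of_set {0..}) (top_of_set {0..}) ?f ?g"
    unfolding homeomorphic_maps_def continuous_map_subtopology_eu using gf fg by auto
  then show ?thesis
    using homeomorphic_map_maps by blast
qed

lemma triadic_scale:
  fixes s :: real
  assumes "0 < s" "s \<le> 1"
  obtains k where "1 / 3 ^ Suc k < s" "s \<le> 1 / 3 ^ k"
proof -
  define n where "n = (LEAST n. 1 / 3 ^ n < s)"
  obtain m where "(1 / 3) ^ m < s"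
    using real_arch_pow_inv[OF assms(1), of "1 / 3"] by auto
  then have "1 / 3 ^ m < s" by (simp add: power_one_over)
  then have n: "1 / 3 ^ n < s" unfolding n_def by (rule LeastI)
  with assms(2) have "n \<noteq> 0" by (intro notI) simp
  then obtain k where k: "n = Suc k" using not0_implies_Suc by blast
  then have "\<not> 1 / 3 ^ k < s"
    unfolding n_def by (intro not_less_Least) simp
  then show thesis using that n k by (simp add: not_less)
qed

lemma infnorm_unit_cube:
  assumes "x \<in> unit_cube" "y \<in> unit_cube"
  shows "infnorm (x - y) \<le> 1"
proof (rule infnorm_le_cart)
  fix i
  have "0 \<le> x $ i" "x $ i \<le> 1" "0 \<le> y $ i" "y $ i \<le> 1"
    using assms by (auto simp: unit_cube_def)
  then show "\<bar>(x - y) $ i\<bar> \<le> 1" by simp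
qed

section \<open>Comparison of the distance with Euclidean scales\<close>

context cascade
begin

abbreviation point_weight :: "nat \<Rightarrow> real ^ 'n \<Rightarrow> real"
  where "point_weight k x \<equiv> weight e k (addr k x)"

lemma point_weight_le: "point_weight (k + m) x \<le> (1 / 2) ^ m * point_weight k x"
  using weight_add_le[of k m "addr (k + m) x"] by (simp add: addr_div)

lemma point_weight_ge: "e ^ m * point_weight k x \<le> point_weight (k + m) x"
  using weight_add_ge[of m k "addr (k + m) x"] by (simp add: addr_div)

text \<open>Up to powers of \<open>e\<close>, the distance is the weight of the cell around
  \<open>x\<close> whose side matches the sup-norm distance.\<close>

lemma cdist_bounds:
  assumes x: "x \<in> unit_cube" and y: "y \<in> unit_cube"
    and s: "1 / 3 ^ Suc k < infnorm (x - y)" "infnorm (x - y) \<le> 1 / 3 ^ k"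
  shows "e * cdist e x y \<le> point_weight k x" "e ^ 3 * point_weight k x \<le> cdist e x y"
proof -
  have x0: "\<And>i. 0 \<le> x $ i" and y0: "\<And>i. 0 \<le> y $ i"
    using x y by (auto simp: unit_cube_def)
  have "\<bar>x $ i - y $ i\<bar> \<le> 1 / 3 ^ k" for i
    using component_le_infnorm_cart[of "x - y" i] s(2) by simp
  then show "e * cdist e x y \<le> point_weight k x"
    by (rule cdist_le[OF x0 y0])
  obtain i where "\<not> \<bar>(x - y) $ i\<bar> \<le> 1 / 3 ^ Suc k"
    using s(1) infnorm_le_cart[of "x - y"] not_le by blast
  \<comment> \<open>\<open>cdist_ge\<close> needs two cell sides, hence level \<open>k + 2\<close>;
    going down two levels costs \<open>e ^ 2\<close>.\<close>
  then have "2 / 3 ^ (k + 2) \<le> \<bar>x $ i - y $ i\<bar>"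
    by (simp add: field_simps)
  then have "e * point_weight (k + 2) x \<le> cdist e x y"
    by (rule cdist_ge[OF x0 y0])
  moreover have "e * (e ^ 2 * point_weight k x) \<le> e * point_weight (k + 2) x"
    using point_weight_ge[of 2 k x] e_pos by (intro mult_left_mono) auto
  ultimately show "e ^ 3 * point_weight k x \<le> cdist e x y"
    by (simp add: power3_eq_cube power2_eq_square mult_ac)
qed

lemma cdist_pos:
  assumes "x \<in> unit_cube" "y \<in> unit_cube" "x \<noteq> y"
  shows "0 < cdist e x y"
proof -
  have "0 < infnorm (x - y)" using assms(3) by (simp add: infnorm_pos_lt)
  then obtain k where "1 / 3 ^ Suc k < infnorm (x - y)" "infnorm (x - y) \<le> 1 / 3 ^ k"
    using triadic_scale infnorm_unit_cube[OF assms(1,2)] by blast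
  from cdist_bounds(2)[OF assms(1,2) this] show ?thesis
    using e_pos weight_pos[of k "addr k x"] by (smt (verit) mult_pos_pos zero_less_power)
qed

lemma Metric_space_cdist: "Metric_space unit_cube (cdist e)"
proof
  fix x y :: "real ^ 'n"
  assume "x \<in> unit_cube" "y \<in> unit_cube"
  then show "cdist e x y = 0 \<longleftrightarrow> x = y"
    using cdist_pos[of x y] cdist_self[of x] by (cases "x = y") auto
qed (auto simp: cdist_nonneg cdist_commute cdist_triangle)

definition cascade_metric :: "(real ^ 'n) metric"
  where "cascade_metric = metric (unit_cube, cdist e)"

lemma mspace_cascade_metric [simp]: "mspace cascade_metric = unit_cube"
  unfolding cascade_metric_def by (rule Metric_space.mspace_metric[OF Metric_space_cdist])

lemma mdist_cascade_metric [simp]: "mdist cascade_metric = cdist e"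
  unfolding cascade_metric_def by (rule Metric_space.mdist_metric[OF Metric_space_cdist])

text \<open>Compare the cells of \<open>x\<close> at the levels of the two distances. If
  \<open>y\<close> is nearer, weights at least halve per level, giving the square root; if
  \<open>y\<close> is farther, they shrink at most by \<open>e = 1 / 3 ^ b\<close> per level, giving
  the power \<open>b\<close>.\<close>

lemma cdist_ratio:
  assumes b: "e = 1 / 3 ^ b"
    and x: "x \<in> unit_cube" and y: "y \<in> unit_cube" and z: "z \<in> unit_cube"
    and neq: "x \<noteq> y" "x \<noteq> z"
    and t: "t = infnorm (x - y) / infnorm (x - z)"
  shows "cdist e x y / cdist e x z \<le> 2 / e ^ 5 * max (sqrt t) (t ^ b)"
proof -
  have pos: "0 < infnorm (x - y)" "0 < infnorm (x - z)"
    using neq by (simp_all add: infnorm_pos_lt)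
  obtain k where k: "1 / 3 ^ Suc k < infnorm (x - y)" "infnorm (x - y) \<le> 1 / 3 ^ k"
    using triadic_scale pos(1) infnorm_unit_cube[OF x y] by blast
  obtain l where l: "1 / 3 ^ Suc l < infnorm (x - z)" "infnorm (x - z) \<le> 1 / 3 ^ l"
    using triadic_scale pos(2) infnorm_unit_cube[OF x z] by blast
  have t0: "0 < t" using pos by (simp add: t)
  have tlow: "3 ^ l / 3 ^ Suc k \<le> t"
  proof -
    have "3 ^ l / 3 ^ Suc k = (1 / 3 ^ Suc k) / (1 / 3 ^ l :: real)" by simp
    also have "\<dots> \<le> t" unfolding t using k l pos by (intro frac_le) auto
    finally show ?thesis .
  qed
  let ?A = "max (sqrt t) (t ^ b)"
  have W0: "0 < point_weight l x" by (rule weight_pos)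
  have e1: "e \<le> 1" using e_le by simp
  have "e * point_weight k x \<le> 2 * ?A * point_weight l x"
  proof (cases "l \<le> k")
    case True
    then obtain m where m: "k = l + m" using le_Suc_ex by blast
    \<comment> \<open>The square root works because 1/4 is at most 1/3. The factor 2 below pays for
      the extra level in \<open>tlow\<close>.\<close>
    have "(1 / 2) ^ Suc m = sqrt ((1 / 4) ^ Suc m)"
      by (simp add: real_sqrt_power real_sqrt_divide)
    also have "\<dots> \<le> sqrt ((1 / 3) ^ Suc m)"
      by (intro real_sqrt_le_mono power_mono) auto
    also have "\<dots> \<le> sqrt t"
      using tlow by (simp add: m power_add power_one_over field_simps)
    finally have "(1 / 2) ^ m \<le> 2 * ?A" by simp
    then have "(1 / 2) ^ m * point_weight l x \<le> 2 * ?A * point_weight l x"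
      using W0 by (intro mult_right_mono) auto
    moreover have "e * point_weight k x \<le> 1 * point_weight k x"
      by (intro mult_right_mono e1 weight_nonneg)
    ultimately show ?thesis using point_weight_le[of l m x] m by simp
  next
    case False
    then obtain m where m: "l = Suc (k + m)"
      using less_imp_Suc_add[of k l] by auto
    have "3 ^ m \<le> t"
      using tlow by (simp add: m power_add field_simps)
    then have "(3 ^ m) ^ b \<le> t ^ b" by (intro power_mono) auto
    then have "(3 ^ b) ^ m \<le> ?A"
      by (simp add: power_mult[symmetric] mult.commute)
    then have eA: "1 \<le> e ^ m * ?A"
      by (simp add: b power_divide field_simps)
    have "e ^ Suc m * point_weight k x \<le> point_weight l x"
      using point_weight_ge[of "Suc m" k x] by (simp add: m)
    then have "?A * (e ^ Suc m * point_weight k x) \<le> ?A * point_weight l x"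
      using t0 by (intro mult_left_mono) (auto simp: le_max_iff_disj)
    moreover have "1 * (e * point_weight k x) \<le> e ^ m * ?A * (e * point_weight k x)"
      using e_pos weight_nonneg[of k "addr k x"] by (intro mult_right_mono eA) auto
    moreover have "e ^ m * ?A * (e * point_weight k x) = ?A * (e ^ Suc m * point_weight k x)"
      by simp
    moreover have "0 \<le> ?A * point_weight l x"
      using t0 W0 by (auto simp: le_max_iff_disj)
    ultimately show ?thesis by linarith
  qed
  \<comment> \<open>Of the five factors \<open>e\<close>, three come from the lower bound for
    \<open>cdist e x z\<close>, one from the upper bound for \<open>cdist e x y\<close>, and one
    from the weight comparison.\<close>
  then have "e ^ 3 * (e * (e * cdist e x y)) \<le> e ^ 3 * (2 * ?A * point_weight l x)"
    using cdist_bounds(1)[OF x y k] e_pos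
    by (intro mult_left_mono) (auto intro: order_trans[OF mult_left_mono])
  also have "\<dots> = 2 * ?A * (e ^ 3 * point_weight l x)" by simp
  also have "\<dots> \<le> 2 * ?A * cdist e x z"
    using cdist_bounds(2)[OF x z l] t0 by (intro mult_left_mono) (auto simp: le_max_iff_disj)
  finally have "e ^ 5 * cdist e x y \<le> 2 * ?A * cdist e x z"
    by (simp add: numeral_eq_Suc mult_ac)
  then show ?thesis
    using cdist_pos[OF x z neq(2)] e_pos by (simp add: field_simps)
qed

text \<open>Forward continuity uses the uniform decay of weights; for the inverse, a distance below
  \<open>e * point_weight k a\<close> bounds all coordinate differences by
  \<open>cdist_ge\<close>.\<close>

lemma homeomorphic_map_cascade:
  "homeomorphic_map (mtopology_of (cube_metric :: (real ^ 'n) metric)) (mtopology_of cascade_metric) id"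
proof -
  interpret M1: Metric_space "unit_cube :: (real ^ 'n) set" dist
    using Met_TC.subspace by blast
  interpret M2: Metric_space "unit_cube :: (real ^ 'n) set" "cdist e"
    by (rule Metric_space_cdist)
  have 1: "continuous_map M1.mtopology M2.mtopology id"
    unfolding M1.metric_continuous_map[OF M2.Metric_space_axioms]
  proof (intro conjI ballI allI impI)
    fix a :: "real ^ 'n" and d :: real
    assume a: "a \<in> unit_cube" and d: "0 < d"
    obtain k where k: "(1 / 2) ^ k < e * d"
      using real_arch_pow_inv[of "e * d" "1 / 2"] d e_pos by auto
    have "cdist e a x < d" if x: "x \<in> unit_cube" "dist a x < 1 / 3 ^ k" for x
    proof -
      have "\<bar>a $ i - x $ i\<bar> \<le> 1 / 3 ^ k" for i
        using component_le_norm_cart[of "a - x" i] x(2) by (simp add: dist_norm)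
      then have "e * cdist e a x \<le> point_weight k a"
        using a x(1) by (intro cdist_le) (auto simp: unit_cube_def)
      also have "\<dots> < e * d" using weight_le[of k "addr k a"] k by simp
      finally show ?thesis using e_pos by simp
    qed
    then show "\<exists>\<delta>>0. \<forall>x. x \<in> unit_cube \<and> dist a x < \<delta> \<longrightarrow> cdist e (id a) (id x) < d"
      by (intro exI[of _ "1 / 3 ^ k"]) simp
  qed auto
  have 2: "continuous_map M2.mtopology M1.mtopology id"
    unfolding M2.metric_continuous_map[OF M1.Metric_space_axioms]
  proof (intro conjI ballI allI impI)
    fix a :: "real ^ 'n" and d :: real
    assume a: "a \<in> unit_cube" and d: "0 < d"
    \<comment> \<open>The 2 is the separation in \<open>cdist_ge\<close>, the root compares
      Euclidean and sup norm.\<close>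
    let ?c = "2 * sqrt (real DIM(real ^ 'n))"
    have c0: "0 < ?c" by simp
    then obtain k where "(1 / 3) ^ k < d / ?c"
      using real_arch_pow_inv[of "d / ?c" "1 / 3"] d by auto
    then have k: "?c / 3 ^ k < d"
      using c0 by (simp add: pos_less_divide_eq power_one_over mult.commute)
    have "dist a x < d" if x: "x \<in> unit_cube" "cdist e a x < e * point_weight k a" for x
    proof -
      have "\<bar>(a - x) $ i\<bar> \<le> 2 / 3 ^ k" for i
        using cdist_ge[of a x k i] a x by (force simp: unit_cube_def)
      then have "infnorm (a - x) \<le> 2 / 3 ^ k" by (rule infnorm_le_cart)
      then have "sqrt (real DIM(real ^ 'n)) * infnorm (a - x) \<le> sqrt (real DIM(real ^ 'n)) * (2 / 3 ^ k)"
        by (intro mult_left_mono) auto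
      then show ?thesis
        using norm_le_infnorm[of "a - x"] k by (simp add: dist_norm mult.commute)
    qed
    then show "\<exists>\<delta>>0. \<forall>x. x \<in> unit_cube \<and> cdist e a x < \<delta> \<longrightarrow> dist (id a) (id x) < d"
      using e_pos weight_pos[of k "addr k a"]
      by (intro exI[of _ "e * point_weight k a"]) simp
  qed auto
  have "homeomorphic_map M1.mtopology M2.mtopology id"
    using 1 2 unfolding homeomorphic_map_maps homeomorphic_maps_def by (intro exI[of _ id]) simp
  moreover have "mtopology_of cube_metric = M1.mtopology"
    by (simp add: cube_metric_def mtopology_of_def)
  moreover have "mtopology_of cascade_metric = M2.mtopology"
    by (simp add: mtopology_of_def)
  ultimately show ?thesis by simp
qed

lemma quasisymmetric_cascade:
  assumes b: "e = 1 / 3 ^ b" "0 < b"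
  shows "quasisymmetric_map cube_metric (cascade_metric :: (real ^ 'n) metric) id"
proof -
  \<comment> \<open>Passing from sup-norm to Euclidean ratios costs at most this factor, which the
    gauge absorbs.\<close>
  define c where "c = sqrt (real DIM(real ^ 'n))"
  have c: "0 < c" by (simp add: c_def)
  have "cdist e x y / cdist e x z \<le>
      2 / e ^ 5 * max (sqrt (c * (dist x y / dist x z))) ((c * (dist x y / dist x z)) ^ b)"
    if "x \<in> unit_cube" "y \<in> unit_cube" "z \<in> unit_cube" "x \<noteq> y" "x \<noteq> z" for x y z :: "real ^ 'n"
  proof -
    define t where "t = infnorm (x - y) / infnorm (x - z)"
    have pos: "0 < infnorm (x - y)" "0 < infnorm (x - z)" "0 < norm (x - z)"
      using that by (simp_all add: infnorm_pos_lt)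
    have "t \<le> norm (x - y) / (norm (x - z) / c)"
      unfolding t_def using pos c norm_le_infnorm[of "x - z"] infnorm_le_norm[of "x - y"]
      by (intro frac_le) (auto simp: c_def field_simps)
    then have "t \<le> c * (dist x y / dist x z)" by (simp add: dist_norm mult.commute)
    moreover have "0 \<le> t" using pos by (simp add: t_def)
    ultimately have "max (sqrt t) (t ^ b) \<le>
        max (sqrt (c * (dist x y / dist x z))) ((c * (dist x y / dist x z)) ^ b)"
      by (intro max.mono real_sqrt_le_mono power_mono)
    then have "2 / e ^ 5 * max (sqrt t) (t ^ b) \<le>
        2 / e ^ 5 * max (sqrt (c * (dist x y / dist x z))) ((c * (dist x y / dist x z)) ^ b)"
      using e_pos by (intro mult_left_mono) auto
    then show ?thesis
      using cdist_ratio[OF b(1) that t_def] by linarith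
  qed
  then show ?thesis
    unfolding quasisymmetric_map_def
    using homeomorphic_map_cascade homeomorphic_map_power_gauge[OF c _ b(2), of "2 / e ^ 5"] e_pos
    by (intro conjI exI[of _ "\<lambda>t. 2 / e ^ 5 * max (sqrt (c * t)) ((c * t) ^ b)"])
      (auto simp: cube_metric_def)
qed

end

section \<open>Dimension\<close>

definition cells_at :: "nat \<Rightarrow> ('n \<Rightarrow> nat) set"
  where "cells_at k = {v. \<forall>i. v i < 3 ^ k}"

lemma cells_at_PiE: "cells_at k = (PiE UNIV (\<lambda>_. {..<3 ^ k}) :: ('n \<Rightarrow> nat) set)"
  by (auto simp: cells_at_def PiE_def Pi_def)

lemma finite_cells_at: "finite (cells_at k :: ('n::finite \<Rightarrow> nat) set)"
  unfolding cells_at_PiE by (intro finite_PiE) auto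

lemma card_cells_at: "card (cells_at k :: ('n::finite \<Rightarrow> nat) set) = (3 ^ k) ^ CARD('n)"
  unfolding cells_at_PiE by (subst card_PiE) auto

lemma cell_subset_unit_cube:
  assumes "v \<in> cells_at k"
  shows "cell k v \<subseteq> (unit_cube :: (real ^ 'n) set)"
proof
  fix x :: "real ^ 'n"
  assume x: "x \<in> cell k v"
  have "x $ i \<le> 1" for i
  proof -
    have "v i + 1 \<le> 3 ^ k" using assms by (auto simp: cells_at_def Suc_le_eq)
    then have "real (v i + 1) \<le> real (3 ^ k)" using of_nat_le_iff by blast
    moreover have "3 ^ k * x $ i \<le> real (v i) + 1" using x by (simp add: mem_cell)
    ultimately have "3 ^ k * x $ i \<le> 3 ^ k * 1"
      by (simp only: of_nat_add of_nat_1 of_nat_power of_nat_numeral mult_1_right)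
    then show ?thesis by (rule mult_left_le_imp_le) simp
  qed
  then show "x \<in> unit_cube"
    using cell_nonneg[OF x] by (simp add: unit_cube_def)
qed

lemma unit_cube_subset_cells: "(unit_cube :: (real ^ 'n) set) \<subseteq> (\<Union>v \<in> cells_at k. cell k v)"
proof
  fix x :: "real ^ 'n"
  assume "x \<in> unit_cube"
  \<comment> \<open>Refining the unit cell, instead of taking \<open>addr\<close>, keeps indices
    below \<open>3 ^ k\<close> on the upper faces.\<close>
  then have "x \<in> cell 0 (\<lambda>_. 0)" by (simp add: unit_cube_def mem_cell)
  then obtain w where w: "x \<in> cell (0 + k) w" "\<And>i. w i div 3 ^ k = 0"
    using cell_refine[of x 0 "\<lambda>_. 0" k] by blast
  have "w i < 3 ^ k" for i
    using w(2)[of i] by (simp add: div_eq_0_iff)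
  then show "x \<in> (\<Union>v \<in> cells_at k. cell k v)"
    using w(1) by (auto simp: cells_at_def)
qed

lemma emeasure_cell: "emeasure lborel (cell k v :: (real ^ 'n) set) = ennreal ((1 / 3 ^ k) ^ CARD('n))"
proof -
  have ne: "(cell k v :: (real ^ 'n) set) \<noteq> {}"
    unfolding cell_def interval_ne_empty_cart by (auto simp: field_simps)
  have "measure lborel (cell k v :: (real ^ 'n) set) = (1 / 3 ^ k) ^ CARD('n)"
    using ne unfolding cell_def
    by (subst content_cbox_cart) (auto simp: diff_divide_distrib[symmetric])
  moreover have "emeasure lborel (cell k v :: (real ^ 'n) set) = ennreal (measure lborel (cell k v :: (real ^ 'n) set))"
    unfolding cell_def by (intro emeasure_eq_ennreal_measure less_imp_neq emeasure_lborel_cbox_finite[unfolded infinity_ennreal_def])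
  ultimately show ?thesis by simp
qed

lemma power_powr: "0 < x \<Longrightarrow> (x ^ k) powr a = (x powr a) ^ k" for x a :: real
  by (simp add: powr_power powr_powr mult.commute flip: powr_realpow)

text \<open>The weight is a product over ternary digit vectors. Splitting off the last one by
  \<open>v = 3 * u + w\<close> factorises the sum.\<close>

lemma sum_weight_powr:
  fixes \<sigma> :: real
  assumes "0 < e"
  shows "(\<Sum>v \<in> (cells_at k :: ('n::finite \<Rightarrow> nat) set). weight e k v powr \<sigma>) =
    (\<Sum>w \<in> (cells_at 1 :: ('n \<Rightarrow> nat) set). (if \<forall>i. w i = 1 then e else 1 / 2) powr \<sigma>) ^ k"
proof (induction k)
  case 0
  have "cells_at 0 = {\<lambda>_::'n. 0::nat}" by (auto simp: cells_at_def)
  then show ?case by simp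
next
  case (Suc k)
  let ?g = "\<lambda>w :: 'n \<Rightarrow> nat. (if \<forall>i. w i = 1 then e else 1 / 2) powr \<sigma>"
  have pos: "0 \<le> weight e k v" for v :: "'n \<Rightarrow> nat"
    using assms by (induction k arbitrary: v) auto
  have "(\<Sum>v \<in> (cells_at (Suc k) :: ('n \<Rightarrow> nat) set). weight e (Suc k) v powr \<sigma>) =
      (\<Sum>(u, w) \<in> (cells_at k :: ('n \<Rightarrow> nat) set) \<times> cells_at 1. weight e k u powr \<sigma> * ?g w)"
  proof (rule sum.reindex_bij_witness[where i = "\<lambda>(u, w) (i :: 'n). 3 * u i + w i :: nat"
        and j = "\<lambda>v :: 'n \<Rightarrow> nat. (\<lambda>i :: 'n. v i div 3, \<lambda>i. v i mod 3)"])
    fix v :: "'n \<Rightarrow> nat"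
    assume "v \<in> cells_at (Suc k)"
    then show "(\<lambda>i. v i div 3, \<lambda>i. v i mod 3) \<in> cells_at k \<times> cells_at 1"
      by (auto simp: cells_at_def less_mult_imp_div_less mult.commute)
    show "(case (\<lambda>i. v i div 3, \<lambda>i. v i mod 3) of (u, w) \<Rightarrow> weight e k u powr \<sigma> * ?g w) =
        weight e (Suc k) v powr \<sigma>"
      using pos assms by (simp add: powr_mult)
  next
    fix p :: "('n \<Rightarrow> nat) \<times> ('n \<Rightarrow> nat)"
    assume "p \<in> cells_at k \<times> cells_at 1"
    then obtain u w where p: "p = (u, w)" "\<And>i. u i < 3 ^ k" "\<And>i. w i < 3"
      by (auto simp: cells_at_def)
    then show "(\<lambda>v. (\<lambda>i. v i div 3, \<lambda>i. v i mod 3)) (case p of (u, w) \<Rightarrow> \<lambda>i. 3 * u i + w i) = p"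
      by (auto simp: fun_eq_iff)
    have "3 * u i + w i < 3 * 3 ^ k" for i
      using p(2)[of i] p(3)[of i] by linarith
    then show "(case p of (u, w) \<Rightarrow> \<lambda>i. 3 * u i + w i) \<in> cells_at (Suc k)"
      by (simp add: p(1) cells_at_def)
  qed auto
  also have "\<dots> = (\<Sum>u \<in> (cells_at k :: ('n \<Rightarrow> nat) set). weight e k u powr \<sigma>) * (\<Sum>w \<in> cells_at 1. ?g w)"
    by (simp add: sum_product sum.cartesian_product)
  finally show ?case using Suc by simp
qed

section \<open>Good cells, full measure and dimension\<close>

context cascade
begin

text \<open>Up to a factor \<open>4\<^sup>-\<^sup>k\<close>, the threshold is the Lebesgue measure of a cell of level \<open>k\<close>. Hence the
  \<open>\<alpha>\<close>-th powers of the diameters of all good cells have a finite sum over all levels.\<close>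

definition good :: "real \<Rightarrow> nat \<Rightarrow> ('n::finite \<Rightarrow> nat) set"
  where "good \<alpha> k = {v \<in> cells_at k. weight e k v powr \<alpha> \<le> (1 / (4 * 3 ^ CARD('n))) ^ k}"

definition limsup_good :: "real \<Rightarrow> (real ^ 'n) set"
  where "limsup_good \<alpha> = (\<Inter>K. \<Union>k \<in> {K..}. \<Union>v \<in> good \<alpha> k. cell k v)"

lemma finite_good: "finite (good \<alpha> k)"
  unfolding good_def using finite_cells_at by (rule finite_subset[rotated]) auto

text \<open>Markov's inequality for the power \<open>\<alpha> * \<theta>\<close> of the weight, whose mean is multiplicative in \<open>k\<close>.
  For small \<open>e\<close> the central child contributes almost nothing to the mean.\<close>

lemma card_bad_le:
  fixes \<alpha> \<theta> :: real
  assumes "0 \<le> \<theta>" and \<sigma>: "0 \<le> \<alpha> * \<theta>" and e: "e powr (\<alpha> * \<theta>) \<le> 1 / 2"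
  shows "real (card (cells_at k - good \<alpha> k :: ('n::finite \<Rightarrow> nat) set)) \<le>
    ((4 * 3 ^ CARD('n)) powr \<theta> * (3 ^ CARD('n) - 1 / 2)) ^ k"
proof -
  let ?A = "4 * 3 ^ CARD('n) :: real"
  let ?B = "cells_at k - good \<alpha> k :: ('n \<Rightarrow> nat) set"
  let ?g = "\<lambda>w :: 'n \<Rightarrow> nat. (if \<forall>i. w i = 1 then e else 1 / 2) powr (\<alpha> * \<theta>)"
  \<comment> \<open>A bad cell exceeds the threshold, so this quantity dominates the indicator of
    badness.\<close>
  have "1 \<le> (?A powr \<theta>) ^ k * weight e k v powr (\<alpha> * \<theta>)" if "v \<in> ?B" for v
  proof -
    have "(1 / ?A) ^ k \<le> weight e k v powr \<alpha>"
      using that by (auto simp: good_def)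
    then have "((1 / ?A) ^ k) powr \<theta> \<le> (weight e k v powr \<alpha>) powr \<theta>"
      using assms(1) by (intro powr_mono2) auto
    also have "\<dots> = weight e k v powr (\<alpha> * \<theta>)" by (simp add: powr_powr)
    also have "((1 / ?A) ^ k) powr \<theta> = 1 / (?A powr \<theta>) ^ k"
      by (subst power_powr) (simp_all add: powr_divide power_divide)
    finally show ?thesis
      by (simp add: field_simps)
  qed
  then have "real (card ?B) \<le> (\<Sum>v\<in>?B. (?A powr \<theta>) ^ k * weight e k v powr (\<alpha> * \<theta>))"
    using sum_mono[of ?B "\<lambda>_. 1::real"] by simp
  also have "\<dots> \<le> (\<Sum>v\<in>(cells_at k :: ('n \<Rightarrow> nat) set). (?A powr \<theta>) ^ k * weight e k v powr (\<alpha> * \<theta>))"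
    by (intro sum_mono2 finite_cells_at) auto
  also have "\<dots> = (?A powr \<theta> * (\<Sum>w\<in>cells_at 1. ?g w)) ^ k"
    unfolding sum_distrib_left[symmetric] by (subst sum_weight_powr[OF e_pos]) (simp add: power_mult_distrib)
  also have "\<dots> \<le> (?A powr \<theta> * (3 ^ CARD('n) - 1 / 2)) ^ k"
  proof (intro power_mono mult_left_mono)
    have m: "(\<lambda>_. 1) \<in> (cells_at 1 :: ('n \<Rightarrow> nat) set)" by (simp add: cells_at_def)
    have "(\<Sum>w\<in>cells_at 1. ?g w) = ?g (\<lambda>_. 1) + (\<Sum>w\<in>cells_at 1 - {\<lambda>_. 1}. ?g w)"
      by (rule sum.remove[OF finite_cells_at m])
    \<comment> \<open>The central child gives at most 1/2; each other child is bounded crudely by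
      1.\<close>
    also have "\<dots> \<le> 1 / 2 + (\<Sum>w\<in>(cells_at 1 :: ('n \<Rightarrow> nat) set) - {\<lambda>_. 1}. 1)"
    proof (intro add_mono sum_mono)
      show "?g (\<lambda>_. 1) \<le> 1 / 2" using e by simp
      fix w :: "'n \<Rightarrow> nat"
      show "?g w \<le> 1"
        using e_pos e_le \<sigma> by (intro powr_le1) auto
    qed
    also have "\<dots> = 3 ^ CARD('n) - 1 / 2"
      using m by (simp add: card_Diff_singleton card_cells_at of_nat_diff)
    finally show "(\<Sum>w\<in>cells_at 1. ?g w) \<le> 3 ^ CARD('n) - 1 / 2" .
  qed (auto intro!: mult_nonneg_nonneg sum_nonneg)
  finally show ?thesis .
qed

lemma limsup_good_borel: "limsup_good \<alpha> \<in> sets borel"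
proof -
  have "(\<Union>v \<in> good \<alpha> k. cell k v) \<in> sets borel" for k
    using finite_good by (intro sets.finite_UN) (auto simp: cell_def)
  then show ?thesis
    unfolding limsup_good_def by (intro sets.countable_INT'' sets.countable_UN') auto
qed

lemma limsup_good_subset: "limsup_good \<alpha> \<subseteq> unit_cube"
  unfolding limsup_good_def using cell_subset_unit_cube by (fastforce simp: good_def)

text \<open>Multiplying the count by the cell volume, the bad cells of level \<open>k\<close> have
  total measure at most \<open>q ^ k\<close>. A point outside the limit set lies in bad cells at all
  large levels.\<close>

lemma null_unit_cube_diff_limsup_good:
  fixes \<alpha> q :: real
  assumes bad: "\<And>k. real (card (cells_at k - good \<alpha> k :: ('n::finite \<Rightarrow> nat) set)) \<le> (q * 3 ^ CARD('n)) ^ k"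
    and q: "0 \<le> q" "q < 1"
  shows "emeasure lebesgue (unit_cube - limsup_good \<alpha> :: (real ^ 'n) set) = 0"
proof -
  \<comment> \<open>Cells are closed, so \<open>N K\<close> may also contain points of good cells;
    only covering the exceptional points matters.\<close>
  define N where "N K = (\<Inter>k \<in> {K..}. \<Union>v \<in> cells_at k - good \<alpha> k. cell k v :: (real ^ 'n) set)" for K
  have "emeasure lborel (N K) = 0" for K
  proof -
    have le: "emeasure lborel (N K) \<le> ennreal (q ^ k)" if "K \<le> k" for k
    proof -
      let ?B = "cells_at k - good \<alpha> k :: ('n \<Rightarrow> nat) set"
      have fin: "finite ?B" using finite_cells_at by blast
      have "emeasure lborel (N K) \<le> emeasure lborel (\<Union>v \<in> ?B. cell k v :: (real ^ 'n) set)"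
        using that fin by (intro emeasure_mono) (auto simp: N_def cell_def)
      also have "\<dots> \<le> (\<Sum>v\<in>?B. emeasure lborel (cell k v :: (real ^ 'n) set))"
        using fin by (intro emeasure_subadditive_finite) (auto simp: cell_def)
      also have "\<dots> = ennreal (real (card ?B) * (1 / 3 ^ k) ^ CARD('n))"
        by (simp add: emeasure_cell ennreal_mult ennreal_of_nat_eq_real_of_nat)
      also have "\<dots> \<le> ennreal ((q * 3 ^ CARD('n)) ^ k * (1 / 3 ^ k) ^ CARD('n))"
        by (intro ennreal_leI mult_right_mono bad) auto
      also have "(q * 3 ^ CARD('n)) ^ k * (1 / 3 ^ k) ^ CARD('n) = q ^ k"
        by (simp add: power_mult_distrib power_divide power_mult[symmetric] mult.commute)
      finally show ?thesis .
    qed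
    have "(\<lambda>k. ennreal (q ^ k)) \<longlonglongrightarrow> ennreal 0"
      using q by (intro tendsto_ennrealI LIMSEQ_realpow_zero)
    then have "emeasure lborel (N K) \<le> ennreal 0"
      using le by (intro LIMSEQ_le_const) auto
    then show ?thesis by simp
  qed
  moreover have "N K \<in> sets lborel" for K
    unfolding N_def using finite_cells_at
    by (intro sets.countable_INT'' sets.finite_UN) (auto simp: cell_def)
  ultimately have null: "(\<Union>K. N K) \<in> null_sets lborel"
    by (intro null_sets_UN) (auto simp: null_sets_def)
  have "unit_cube - limsup_good \<alpha> \<subseteq> (\<Union>K. N K)"
  proof
    fix x :: "real ^ 'n"
    assume x: "x \<in> unit_cube - limsup_good \<alpha>"
    then obtain K where K: "\<And>k v. K \<le> k \<Longrightarrow> v \<in> good \<alpha> k \<Longrightarrow> x \<notin> cell k v"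
      by (auto simp: limsup_good_def)
    have "x \<in> N K"
      unfolding N_def
    proof
      fix k assume "k \<in> {K..}"
      moreover obtain v where "v \<in> cells_at k" "x \<in> cell k v"
        using x unit_cube_subset_cells[of k] by blast
      ultimately show "x \<in> (\<Union>v \<in> cells_at k - good \<alpha> k. cell k v)"
        using K by auto
    qed
    then show "x \<in> (\<Union>K. N K)" by blast
  qed
  moreover have "(\<Union>K. N K) \<in> null_sets lebesgue"
    using null by (simp add: null_sets_completionI)
  ultimately have "(unit_cube - limsup_good \<alpha> :: (real ^ 'n) set) \<in> null_sets lebesgue"
    by (rule null_sets_completion_subset)
  then show ?thesis by (simp add: null_sets_def)
qed

lemma mdiameter_cell_le:
  "mdiameter cascade_metric (cell k v) \<le> ennreal (weight e k v)"
  unfolding mdiameter_def by (auto intro!: SUP_least ennreal_leI cdist_cell)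

text \<open>The good cells of all levels from \<open>K\<close> on cover the set. Level
  \<open>k\<close> has at most \<open>3 ^ (k * n)\<close> of them, \<open>n\<close> being the
  dimension, so it contributes at most \<open>(1 / 4) ^ k\<close>, and the tail vanishes as
  \<open>K\<close> grows.\<close>

lemma hausdorff_measure_limsup_good:
  fixes \<alpha> :: real
  assumes \<alpha>: "0 < \<alpha>"
  shows "hausdorff_measure cascade_metric \<alpha> (limsup_good \<alpha> :: (real ^ 'n) set) = 0"
proof -
  let ?X = "cascade_metric :: (real ^ 'n) metric"
  let ?E = "limsup_good \<alpha> :: (real ^ 'n) set"
  have pre: "hausdorff_premeasure ?X \<alpha> \<delta> ?E \<le> ennreal (2 * (1 / 2) ^ K)"
    if \<delta>: "(1 / 2) ^ K \<le> \<delta>" for \<delta> K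
  proof -
    \<comment> \<open>The premeasure asks for a sequence. Unwanted pairs get the empty set, which
      costs 0, and \<open>g\<close> enumerates all pairs.\<close>
    define V where "V = (\<lambda>(k, v). if K \<le> k \<and> v \<in> good \<alpha> k then cell k v else ({} :: (real ^ 'n) set))"
    define g where "g = from_nat_into (UNIV :: (nat \<times> ('n \<Rightarrow> nat)) set)"
    have g: "bij_betw g UNIV UNIV"
      unfolding g_def by (intro bij_betw_from_nat_into) (auto simp: finite_prod)
    have V_sub: "V p \<subseteq> mspace ?X" for p
      using cell_subset_unit_cube[where 'n = 'n] by (auto simp: V_def good_def split: prod.split)
    have V_diam: "mdiameter ?X (V p) \<le> ennreal \<delta>" for p
    proof (cases p)
      case (Pair k v)
      show ?thesis
      proof (cases "K \<le> k \<and> v \<in> good \<alpha> k")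
        case True
        have "weight e k v \<le> (1 / 2) ^ k" by (rule weight_le)
        also have "\<dots> \<le> (1 / 2) ^ K" using True by (intro power_decreasing) auto
        finally have "weight e k v \<le> \<delta>" using \<delta> by simp
        then show ?thesis
          using True Pair mdiameter_cell_le[of k v] by (auto simp: V_def intro: order_trans ennreal_leI)
      next
        case False
        then have "V p = {}" using Pair by (auto simp: V_def)
        then show ?thesis by (simp add: mdiameter_def bot_ennreal)
      qed
    qed
    have cover: "?E \<subseteq> (\<Union>i. V (g i))"
    proof
      fix x assume "x \<in> ?E"
      then obtain k v where "K \<le> k" "v \<in> good \<alpha> k" "x \<in> cell k v"
        unfolding limsup_good_def by fastforce
      then have "x \<in> V (k, v)" by (simp add: V_def)
      moreover obtain i where "g i = (k, v)"
        using g by (metis bij_betw_imp_surj_on surjD)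
      ultimately show "x \<in> (\<Union>i. V (g i))" by (metis UNIV_I UN_iff)
    qed
    have inner: "(\<integral>\<^sup>+ v. diam_pow ?X \<alpha> (V (k, v)) \<partial>count_space UNIV) \<le> ennreal ((1 / 2) ^ K * (1 / 2) ^ k)" for k
    proof (cases "K \<le> k")
      case True
      have "(\<integral>\<^sup>+ v. diam_pow ?X \<alpha> (V (k, v)) \<partial>count_space UNIV) = (\<Sum>v\<in>good \<alpha> k. diam_pow ?X \<alpha> (V (k, v)))"
        by (intro nn_integral_count_space' finite_good) (auto simp: V_def diam_pow_def)
      also have "\<dots> \<le> (\<Sum>v\<in>(good \<alpha> k :: ('n \<Rightarrow> nat) set). ennreal ((1 / (4 * 3 ^ CARD('n))) ^ k))"
      proof (rule sum_mono)
        fix v :: "'n \<Rightarrow> nat"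
        assume v: "v \<in> good \<alpha> k"
        have "enn2real (mdiameter ?X (cell k v)) \<le> weight e k v"
          using weight_nonneg mdiameter_cell_le by (rule enn2real_leI)
        then have "enn2real (mdiameter ?X (cell k v)) powr \<alpha> \<le> weight e k v powr \<alpha>"
          using \<alpha> by (intro powr_mono2) auto
        also have "\<dots> \<le> (1 / (4 * 3 ^ CARD('n))) ^ k"
          using v by (simp add: good_def)
        finally show "diam_pow ?X \<alpha> (V (k, v)) \<le> ennreal ((1 / (4 * 3 ^ CARD('n))) ^ k)"
          using \<alpha> v True by (auto simp: V_def diam_pow_def intro: ennreal_leI)
      qed
      also have "\<dots> = ennreal (real (card (good \<alpha> k :: ('n \<Rightarrow> nat) set)) * (1 / (4 * 3 ^ CARD('n))) ^ k)"
        by (simp add: ennreal_mult ennreal_of_nat_eq_real_of_nat)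
      also have "\<dots> \<le> ennreal ((1 / 2) ^ K * (1 / 2) ^ k)"
      proof (rule ennreal_leI)
        have "card (good \<alpha> k :: ('n \<Rightarrow> nat) set) \<le> (3 ^ k) ^ CARD('n)"
          unfolding card_cells_at[symmetric]
          by (intro card_mono finite_cells_at) (auto simp: good_def)
        then have "real (card (good \<alpha> k :: ('n \<Rightarrow> nat) set)) \<le> (3 ^ k) ^ CARD('n)"
          by (metis of_nat_le_iff of_nat_numeral of_nat_power)
        then have "real (card (good \<alpha> k :: ('n \<Rightarrow> nat) set)) * (1 / (4 * 3 ^ CARD('n))) ^ k \<le>
            (3 ^ k) ^ CARD('n) * (1 / (4 * 3 ^ CARD('n))) ^ k"
          by (intro mult_right_mono) auto
        also have "\<dots> = (1 / 4) ^ k"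
          by (simp add: power_divide power_mult_distrib power_mult[symmetric] mult.commute)
        \<comment> \<open>One factor supplies the smallness in \<open>K\<close>, the other the
          summability in \<open>k\<close>.\<close>
        also have "\<dots> = (1 / 2) ^ k * (1 / 2) ^ k"
          by (simp add: power_mult_distrib[symmetric])
        also have "\<dots> \<le> (1 / 2) ^ K * (1 / 2) ^ k"
          using True by (intro mult_right_mono power_decreasing) auto
        finally show "real (card (good \<alpha> k :: ('n \<Rightarrow> nat) set)) * (1 / (4 * 3 ^ CARD('n))) ^ k \<le>
          (1 / 2) ^ K * (1 / 2) ^ k" .
      qed
      finally show ?thesis .
    next
      case False
      then show ?thesis by (simp add: V_def diam_pow_def)
    qed
    \<comment> \<open>Integrals over counting measures turn the enumerated sum into an iterated sum
      over levels and cells.\<close>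
    have "(\<Sum>i. diam_pow ?X \<alpha> (V (g i))) = (\<integral>\<^sup>+ i. diam_pow ?X \<alpha> (V (g i)) \<partial>count_space UNIV)"
      by (rule nn_integral_count_space_nat[symmetric])
    also have "\<dots> = (\<integral>\<^sup>+ p. diam_pow ?X \<alpha> (V p) \<partial>count_space UNIV)"
      by (rule nn_integral_bij_count_space[OF g])
    also have "\<dots> = (\<integral>\<^sup>+ k. \<integral>\<^sup>+ v. diam_pow ?X \<alpha> (V (k, v)) \<partial>count_space UNIV \<partial>count_space UNIV)"
      by (rule nn_integral_fst_count_space[symmetric])
    also have "\<dots> \<le> (\<integral>\<^sup>+ k. ennreal ((1 / 2) ^ K * (1 / 2) ^ k) \<partial>count_space UNIV)"
      by (intro nn_integral_mono inner)
    also have "\<dots> = (\<Sum>k. ennreal ((1 / 2) ^ K * (1 / 2) ^ k))"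
      by (rule nn_integral_count_space_nat)
    also have "\<dots> = ennreal (2 * (1 / 2) ^ K)"
    proof (rule suminf_ennreal_eq)
      show "(\<lambda>k. (1 / 2) ^ K * (1 / 2) ^ k) sums (2 * (1 / 2 :: real) ^ K)"
        using sums_mult[OF geometric_sums[of "1 / 2 :: real"], of "(1 / 2) ^ K"] by (simp add: mult.commute)
    qed simp
    finally have "(\<Sum>i. diam_pow ?X \<alpha> (V (g i))) \<le> ennreal (2 * (1 / 2) ^ K)" .
    moreover have "hausdorff_premeasure ?X \<alpha> \<delta> ?E \<le> (\<Sum>i. diam_pow ?X \<alpha> (V (g i)))"
      unfolding hausdorff_premeasure_def
      using V_sub V_diam cover by (intro INF_lower2[of "\<lambda>i. V (g i)"]) auto
    ultimately show ?thesis by (rule order_trans[rotated])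
  qed
  have "hausdorff_premeasure ?X \<alpha> \<delta> ?E = 0" if \<delta>: "0 < \<delta>" for \<delta>
  proof -
    obtain K0 where K0: "(1 / 2) ^ K0 < \<delta>"
      using real_arch_pow_inv[OF \<delta>, of "1 / 2"] by auto
    have "(\<lambda>K. ennreal (2 * (1 / 2) ^ K)) \<longlonglongrightarrow> ennreal (2 * 0)"
      by (intro tendsto_ennrealI tendsto_mult tendsto_const LIMSEQ_realpow_zero) auto
    moreover have "hausdorff_premeasure ?X \<alpha> \<delta> ?E \<le> ennreal (2 * (1 / 2) ^ K)" if "K0 \<le> K" for K
    proof (rule pre)
      have "(1 / 2 :: real) ^ K \<le> (1 / 2) ^ K0" using that by (intro power_decreasing) auto
      then show "(1 / 2) ^ K \<le> \<delta>" using K0 by linarith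
    qed
    ultimately have "hausdorff_premeasure ?X \<alpha> \<delta> ?E \<le> ennreal (2 * 0)"
      by (intro LIMSEQ_le_const) auto
    then show ?thesis by simp
  qed
  then show ?thesis
    unfolding hausdorff_measure_def by (simp add: SUP_eq_const)
qed

end

theorem theorem1p1:
  fixes \<alpha> :: real
  assumes "CARD('n::finite) \<ge> 2"
    and "0 < \<alpha>" and "\<alpha> < real CARD('n)"
  shows "\<exists>(X :: (real ^ 'n) metric) (f :: real ^ 'n \<Rightarrow> real ^ 'n).
           quasisymmetric_map cube_metric X f \<and>
           (\<exists>E. E \<in> sets borel \<and> E \<subseteq> unit_cube \<and>
                emeasure lebesgue (unit_cube - E) = 0 \<and>
                hausdorff_dim X (f ` E) \<le> ennreal \<alpha>)"
proof -
  define M :: real where "M = 3 ^ CARD('n)"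
  have M: "1 \<le> M" by (simp add: M_def)
  \<comment> \<open>This makes \<open>(4 * M) powr \<theta> * (M - 1 / 2)\<close> equal to
    \<open>q * M\<close> with \<open>q < 1\<close>; any number strictly between
    \<open>M - 1 / 2\<close> and \<open>M\<close> could replace \<open>M - 1 / 4\<close>.\<close>
  define \<theta> where "\<theta> = log (4 * M) (M / (M - 1 / 4))"
  have \<theta>: "0 < \<theta>" "(4 * M) powr \<theta> = M / (M - 1 / 4)"
    using M by (simp_all add: \<theta>_def field_simps)
  define q where "q = (M - 1 / 2) / (M - 1 / 4)"
  have q: "0 \<le> q" "q < 1" using M by (simp_all add: q_def field_simps)
  have "(1 / 3 :: real) powr (\<alpha> * \<theta>) < 1"
    using assms(2) \<theta>(1) powr_less_mono2[of "\<alpha> * \<theta>" "1 / 3" 1] by simp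
  \<comment> \<open>Makes \<open>e = 1 / 3 ^ b\<close> so small that the central child contributes
    less than 1/2. The case \<open>b = 0\<close> is excluded because the power would be 1.\<close>
  then obtain b where "((1 / 3 :: real) powr (\<alpha> * \<theta>)) ^ b < 1 / 2"
    using real_arch_pow_inv[of "1 / 2"] by auto
  then have b: "(1 / 3 ^ b :: real) powr (\<alpha> * \<theta>) < 1 / 2" "0 < b"
    using power_powr[of "1 / 3" b "\<alpha> * \<theta>"] by (auto simp: power_one_over intro!: gr0I)
  define e :: real where "e = 1 / 3 ^ b"
  interpret cascade e
  proof
    show "0 < e" by (simp add: e_def)
    have "(3::real) ^ 1 \<le> 3 ^ b" using b(2) by (intro power_increasing) auto
    then show "e \<le> 1 / 2" by (simp add: e_def field_simps)
  qed
  let ?E = "limsup_good \<alpha> :: (real ^ 'n) set"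
  have "real (card (cells_at k - good \<alpha> k :: ('n \<Rightarrow> nat) set)) \<le> (q * 3 ^ CARD('n)) ^ k" for k
  proof -
    have "(4 * 3 ^ CARD('n)) powr \<theta> * (3 ^ CARD('n) - 1 / 2) = q * 3 ^ CARD('n)"
      using \<theta>(2) by (simp add: M_def[symmetric] q_def)
    then show ?thesis
      using card_bad_le[of \<theta> \<alpha> k, where 'n = 'n] \<theta>(1) assms(2) b(1) by (simp add: e_def)
  qed
  from null_unit_cube_diff_limsup_good[OF this q]
  have "emeasure lebesgue (unit_cube - ?E) = 0" .
  moreover have "hausdorff_dim cascade_metric (id ` ?E) \<le> ennreal \<alpha>"
    unfolding hausdorff_dim_def
    using hausdorff_measure_limsup_good[OF assms(2), where 'n = 'n] assms(2)
    by (intro Inf_lower) (auto intro!: exI[of _ \<alpha>])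
  ultimately show ?thesis
    using quasisymmetric_cascade[OF e_def b(2), where 'n = 'n] limsup_good_borel limsup_good_subset
    by blast
qed

end
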